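(* Let $I, J, S\subset \mathbb{R}$ be intervals with $I\cdot J= \{ \lambda x : x\in I, \lambda \in J \}\subset I$ and $1\in J$, $0, 1\in S$. Let further $\gamma, \eta \colon J\times S\to S$ be functions and assume that the one-parameter family of functions $\xi_{s}\colon I\to \mathbb{R}\setminus \{ 0\}$ $(s\in S)$ fulfills $$\xi_{s}(\lambda x)= \gamma(\lambda , s)\,\xi_{\eta(\lambda, s)}(x)\qquad (x\in I,\ \lambda\in J,\ s\in S).$$ If $\eta$ is a regular multiplicatively translational mapping, with associated bijection $H\colon J\to S$, then $$\gamma(\lambda, s)= \frac{\kappa (h(s)\lambda)}{\kappa(h(s))}\qquad (\lambda\in J,\ s\in S)$$ holds, except for the points where the denominator vanishes, where the functions $\kappa$ and $h$ are defined by $$\kappa(\lambda)= \gamma(\lambda, 1)\qquad\text{and}\qquad h(s)= \frac{H^{-1}(s)}{H^{-1}(1)}\qquad (\lambda\in J,\ s\in S).$$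
   Context: Every interval has positive length. For intervals $S,J\subset\mathbb{R}$ with $0\in S$ and $1\in J$, a mapping $\eta\colon J\times S\to S$ is called multiplicatively translational if $\eta(\lambda\tilde{\lambda}, s)= \eta(\tilde{\lambda}, \eta(\lambda, s))$ and also the boundary conditions $\eta(\lambda, 0)=0$ and $\eta(1, s)=s$ hold for all $\lambda, \tilde{\lambda}\in J$ and $s\in S$. A multiplicatively translational mapping $\eta$ is called regular multiplicatively translational if there exists $s^{\ast}\in S$ such that the mapping $J\ni\lambda\mapsto\eta(\lambda,s^\ast)\in S$ is bijective; in other words, there exists a bijective function $H\colon J\to S$ with $H(0)=0$ such that $\eta(\lambda, s)= H(\lambda\cdot H^{-1}(s))$ for all $\lambda\in J$, $s\in S$. This $H$ is the associated bijection.
   Formalization: The identity is asserted only for those s in S with h(s) in J (and κ(h(s)) nonzero), because κ is defined only on J and h(s) may lie outside it, e.g. J=[0,1], S=[0,2], H(λ)=2λ, where h(s)=s. *)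

theory Defs
  imports "HOL-Analysis.Analysis"
begin

text \<open>Intervals may be open, closed, half-open or unbounded, but not degenerate.\<close>

definition nondeg_interval :: "real set \<Rightarrow> bool" where
  "nondeg_interval A \<longleftrightarrow> is_interval A \<and> (\<exists>a\<in>A. \<exists>b\<in>A. a < b)"

text \<open>Two-place functions on \<open>J \<times> S\<close> are functions on pairs whose values outside \<open>J \<times> S\<close> are
  irrelevant.  The equation \<open>\<eta>(\<lambda>\<mu>, s) = \<eta>(\<mu>, \<eta>(\<lambda>, s))\<close> for all \<open>\<lambda>, \<mu> \<in> J\<close> evaluates \<open>\<eta>\<close> at
  \<open>(\<lambda>\<mu>, s)\<close>, so it presupposes that \<open>J\<close> is closed under multiplication; as Isabelle functions are
  total, this is stated explicitly.\<close>

definition mult_translational :: "real set \<Rightarrow> real set \<Rightarrow> (real \<times> real \<Rightarrow> real) \<Rightarrow> bool" where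
  "mult_translational J S \<eta> \<longleftrightarrow>
     \<eta> \<in> J \<times> S \<rightarrow> S \<and>
     (\<forall>l\<in>J. \<forall>m\<in>J. l * m \<in> J) \<and>
     (\<forall>l\<in>J. \<forall>m\<in>J. \<forall>s\<in>S. \<eta> (l * m, s) = \<eta> (m, \<eta> (l, s))) \<and>
     (\<forall>l\<in>J. \<eta> (l, 0) = 0) \<and>
     (\<forall>s\<in>S. \<eta> (1, s) = s)"

definition regular_mult_translational ::
    "real set \<Rightarrow> real set \<Rightarrow> (real \<times> real \<Rightarrow> real) \<Rightarrow> bool" where
  "regular_mult_translational J S \<eta> \<longleftrightarrow>
     mult_translational J S \<eta> \<and> (\<exists>s\<in>S. bij_betw (\<lambda>l. \<eta> (l, s)) J S)"

definition associated_bijection ::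
    "real set \<Rightarrow> real set \<Rightarrow> (real \<times> real \<Rightarrow> real) \<Rightarrow> (real \<Rightarrow> real) \<Rightarrow> bool" where
  "associated_bijection J S \<eta> H \<longleftrightarrow>
     bij_betw H J S \<and> 0 \<in> J \<and> H 0 = 0 \<and>
     (\<forall>l\<in>J. \<forall>s\<in>S. \<eta> (l, s) = H (l * inv_into J H s))"

text \<open>The two descriptions of regularity agree.\<close>

lemma regular_iff_associated_bijection:
  assumes J: "nondeg_interval J" "1 \<in> J" and S: "0 \<in> S"
    and mt: "mult_translational J S \<eta>"
  shows "regular_mult_translational J S \<eta> \<longleftrightarrow> (\<exists>H. associated_bijection J S \<eta> H)"
proof
  assume "regular_mult_translational J S \<eta>"
  then obtain t where t: "t \<in> S" and bij: "bij_betw (\<lambda>l. \<eta> (l, t)) J S"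
    by (auto simp: regular_mult_translational_def)
  define H where "H = (\<lambda>l. \<eta> (l, t))"
  have bH: "bij_betw H J S" using bij by (simp add: H_def)
  have closed: "l * m \<in> J" if "l \<in> J" "m \<in> J" for l m
    using mt that by (auto simp: mult_translational_def)
  have mult: "H (l * m) = \<eta> (m, H l)" if "l \<in> J" "m \<in> J" for l m
    using mt that t by (auto simp: mult_translational_def H_def)
  obtain z where z: "z \<in> J" "H z = 0"
    using bH S by (metis bij_betw_iff_bijections)
  have fix_z: "z * m = z" if "m \<in> J" for m
  proof -
    have "H (z * m) = H z"
      using mult[OF z(1) that] z(2) mt that by (auto simp: mult_translational_def)
    then show ?thesis
      using bH closed[OF z(1) that] z(1) by (metis bij_betw_inv_into_left)
  qed
  obtain a b where "a \<in> J" "b \<in> J" "a < b"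
    using J(1) by (auto simp: nondeg_interval_def)
  then have "z * a = z * b" "a \<noteq> b"
    using fix_z by auto
  then have z0: "z = 0" by simp
  have "\<eta> (l, s) = H (l * inv_into J H s)" if "l \<in> J" "s \<in> S" for l s
    using mult[of "inv_into J H s" l] that bH
    by (metis bij_betw_def bij_betw_inv_into_right inv_into_into mult.commute)
  then show "\<exists>H. associated_bijection J S \<eta> H"
    using bH z z0 unfolding associated_bijection_def by blast
next
  assume "\<exists>H. associated_bijection J S \<eta> H"
  then obtain H where H: "associated_bijection J S \<eta> H" ..
  then have bH: "bij_betw H J S" by (simp add: associated_bijection_def)
  have "H 1 \<in> S" using bH J(2) by (auto simp: bij_betw_def)
  moreover have "\<eta> (l, H 1) = H l" if "l \<in> J" for l
    using H that \<open>H 1 \<in> S\<close> J(2) bH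
    by (simp add: associated_bijection_def bij_betw_inv_into_left)
  then have "bij_betw (\<lambda>l. \<eta> (l, H 1)) J S"
    using bH by (simp cong: bij_betw_cong)
  ultimately show "regular_mult_translational J S \<eta>"
    using mt by (auto simp: regular_mult_translational_def)
qed

end

theory Submission
  imports Defs
begin

text \<open>Evaluating \<open>\<xi> s (\<lambda> * \<mu> * x)\<close> once in a single step and once through \<open>\<mu> * x\<close>, and cancelling the
  nonvanishing \<open>\<xi>\<close>-values, shows that \<open>\<gamma>\<close> is a multiplicative cocycle over the action \<open>\<eta>\<close>:
  \<open>\<gamma>(\<lambda>\<mu>, s) = \<gamma>(\<lambda>, s) \<gamma>(\<mu>, \<eta>(\<lambda>, s))\<close>.  In the coordinate \<open>H\<close> the action is plain multiplication, so the
  parameter \<open>h(s) = H\<^sup>-\<^sup>1(s) / H\<^sup>-\<^sup>1(1)\<close> is the one that moves \<open>1\<close> to \<open>s\<close>.  The cocycle identity based at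
  \<open>1\<close> with \<open>\<lambda> = h(s)\<close> then reads \<open>\<kappa>(h(s) \<mu>) = \<kappa>(h(s)) \<gamma>(\<mu>, s)\<close>.\<close>

text \<open>Because \<open>\<eta>\<close> composes, the one-step and the two-step expansion of \<open>\<xi> s (l * m * x)\<close> end in the
  same factor \<open>\<xi> (\<eta> (l * m, s)) x\<close>; it is nonzero, so the coefficients in front of it agree.\<close>

lemma multiplier_cocycle:
  fixes \<xi> :: "'p \<Rightarrow> 'm::semigroup_mult \<Rightarrow> 'k::field"
  assumes x: "x \<in> I" and IJ: "\<And>l y. l \<in> J \<Longrightarrow> y \<in> I \<Longrightarrow> l * y \<in> I"
    and eqn: "\<And>y l s. y \<in> I \<Longrightarrow> l \<in> J \<Longrightarrow> s \<in> S \<Longrightarrow> \<xi> s (l * y) = \<gamma> (l, s) * \<xi> (\<eta> (l, s)) y"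
    and nonzero: "\<And>s. s \<in> S \<Longrightarrow> \<xi> s x \<noteq> 0"
    and \<eta>_in: "\<And>l s. l \<in> J \<Longrightarrow> s \<in> S \<Longrightarrow> \<eta> (l, s) \<in> S"
    and lm: "l \<in> J" "m \<in> J" "l * m \<in> J" and s: "s \<in> S"
    and action: "\<eta> (l * m, s) = \<eta> (m, \<eta> (l, s))"
  shows "\<gamma> (l * m, s) = \<gamma> (l, s) * \<gamma> (m, \<eta> (l, s))"
proof -
  let ?z = "\<xi> (\<eta> (l * m, s)) x"
  have "\<gamma> (l * m, s) * ?z = \<xi> s (l * (m * x))"
    using eqn[OF x lm(3) s] by (simp add: mult.assoc)
  also have "\<dots> = \<gamma> (l, s) * \<xi> (\<eta> (l, s)) (m * x)"
    by (rule eqn[OF IJ[OF lm(2) x] lm(1) s])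
  also have "\<dots> = (\<gamma> (l, s) * \<gamma> (m, \<eta> (l, s))) * ?z"
    using eqn[OF x lm(2) \<eta>_in[OF lm(1) s]] by (simp add: action mult.assoc)
  finally show ?thesis
    using nonzero[OF \<eta>_in[OF lm(3) s]] by simp
qed

text \<open>The quotient of \<open>H\<close>-coordinates carries \<open>t\<close> to \<open>s\<close>; the base point \<open>t\<close> must avoid the fixed
  point \<open>0\<close>, since exactly there the coordinate \<open>inv_into J H t\<close> vanishes.\<close>

lemma associated_bijection_transport:
  assumes H: "associated_bijection J S \<eta> H"
    and t: "t \<in> S" "t \<noteq> 0" and s: "s \<in> S"
    and J: "inv_into J H s / inv_into J H t \<in> J"
  shows "\<eta> (inv_into J H s / inv_into J H t, t) = s"
proof -
  have bij: "bij_betw H J S" and H0: "H 0 = 0"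
    and \<eta>: "\<And>l u. l \<in> J \<Longrightarrow> u \<in> S \<Longrightarrow> \<eta> (l, u) = H (l * inv_into J H u)"
    using H by (auto simp: associated_bijection_def)
  have "inv_into J H t \<noteq> 0"
    using bij_betw_inv_into_right[OF bij t(1)] H0 t(2) by auto
  then show ?thesis
    using \<eta>[OF J t(1)] bij_betw_inv_into_right[OF bij s] by simp
qed

theorem proposition4:
  fixes I J S :: "real set"
    and \<gamma> \<eta> :: "real \<times> real \<Rightarrow> real"
    and \<xi> :: "real \<Rightarrow> real \<Rightarrow> real"
    and H \<kappa> h :: "real \<Rightarrow> real"
  assumes "nondeg_interval I" and "nondeg_interval J" and "nondeg_interval S"
    and "{l * x |l x. x \<in> I \<and> l \<in> J} \<subseteq> I"
    and "1 \<in> J" and "0 \<in> S" and "1 \<in> S"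
    and "\<gamma> \<in> J \<times> S \<rightarrow> S" and "\<eta> \<in> J \<times> S \<rightarrow> S"
    and "\<forall>s\<in>S. \<xi> s \<in> I \<rightarrow> UNIV - {0}"
    and "\<forall>x\<in>I. \<forall>l\<in>J. \<forall>s\<in>S. \<xi> s (l * x) = \<gamma> (l, s) * \<xi> (\<eta> (l, s)) x"
    and "regular_mult_translational J S \<eta>"
    and "associated_bijection J S \<eta> H"
    and "\<forall>l\<in>J. \<kappa> l = \<gamma> (l, 1)"
    and "\<forall>s\<in>S. h s = inv_into J H s / inv_into J H 1"
  shows "\<forall>l\<in>J. \<forall>s\<in>S. h s \<in> J \<and> \<kappa> (h s) \<noteq> 0 \<longrightarrow>
           \<gamma> (l, s) = \<kappa> (h s * l) / \<kappa> (h s)"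
proof (intro ballI impI)
  note I = assms(1) and IJ = assms(4) and one = assms(5,7) and \<eta>_in = assms(9)
    and \<xi>_nz = assms(10) and eqn = assms(11) and reg = assms(12) and H = assms(13)
    and \<kappa> = assms(14) and h = assms(15)
  fix l s
  assume l: "l \<in> J" and s: "s \<in> S" and hs: "h s \<in> J \<and> \<kappa> (h s) \<noteq> 0"
  obtain x where x: "x \<in> I"
    using I by (auto simp: nondeg_interval_def)
  have closed: "h s * l \<in> J" and action: "\<eta> (h s * l, 1) = \<eta> (l, \<eta> (h s, 1))"
    using reg hs l one by (auto simp: regular_mult_translational_def mult_translational_def)
  have "\<gamma> (h s * l, 1) = \<gamma> (h s, 1) * \<gamma> (l, \<eta> (h s, 1))"
  proof (rule multiplier_cocycle[where I = I and J = J and S = S and x = x and \<xi> = \<xi>])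
    show "k * y \<in> I" if "k \<in> J" "y \<in> I" for k y
      using IJ that by blast
    show "\<xi> u x \<noteq> 0" if "u \<in> S" for u
      using \<xi>_nz that x by (auto simp: Pi_iff)
    show "\<eta> (k, u) \<in> S" if "k \<in> J" "u \<in> S" for k u
      using \<eta>_in that by auto
  qed (use x eqn hs l closed one action in auto)
  moreover have "\<eta> (h s, 1) = s"
    using associated_bijection_transport[OF H one(2) _ s] h s hs by simp
  ultimately have "\<kappa> (h s * l) = \<kappa> (h s) * \<gamma> (l, s)"
    using \<kappa> hs closed by simp
  then show "\<gamma> (l, s) = \<kappa> (h s * l) / \<kappa> (h s)"
    using hs by simp
qed

end
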